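(* Every polynomial $p(x_1,\dots,x_n)$ computed by an arithmetic formula can be represented as an affine projection of a DPP: there exist $N$, a constant matrix $L\in\mathbb{F}^{N\times N}$ and affine linear forms $\ell_1,\dots,\ell_N$ in $x_1,\dots,x_n$ such that $p=\det\big(L+\mathrm{diag}(\ell_1,\dots,\ell_N)\big)$.
   Context: An arithmetic formula is an arithmetic circuit (input nodes labeled by variables or field constants, internal addition and multiplication gates) whose underlying graph is a tree. A determinantal point process (DPP), viewed as a polynomial, is $\det(L+\mathbf{X})$, where $L$ is a constant $N\times N$ matrix and $\mathbf{X}=\mathrm{diag}(y_1,\dots,y_N)$ is a diagonal matrix of variables. An affine projection maps each variable $y_j$ to an affine linear form in (a subset of) the variables $x_1,\dots,x_n$. $\mathbb{F}$ denotes the underlying field (e.g. $\mathbb{Q}$ or $\mathbb{R}$); positive semidefiniteness of $L$ is not required. *)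

theory Defs
  imports "HOL-Library.Poly_Mapping" "Jordan_Normal_Form.Determinant"
begin

text \<open>
  A monomial is a finitely supported map from variable indices to exponents, and a polynomial
  is a finitely supported map from monomials to coefficients; multiplication on
  \<open>\<Rightarrow>\<^sub>0\<close> is convolution. Only finitely many of the countably many
  variables occur in a given polynomial, and the bound to \<open>x\<^sub>1, \<dots>, x\<^sub>n\<close>
  is imposed explicitly below.
\<close>

type_synonym 'a mpoly = "(nat \<Rightarrow>\<^sub>0 nat) \<Rightarrow>\<^sub>0 'a"

definition mConst :: "'a::zero \<Rightarrow> 'a mpoly" where
  "mConst c = Poly_Mapping.single 0 c"

definition mVar :: "nat \<Rightarrow> 'a::zero_neq_one mpoly" where
  "mVar i = Poly_Mapping.single (Poly_Mapping.single i 1) 1"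

text \<open>
  Gates have arbitrary finite fan-in. A gate without inputs computes the constant
  \<open>0\<close> or \<open>1\<close>, hence adds nothing to the computable polynomials.
\<close>

datatype 'a arith_formula =
    Var nat
  | Const 'a
  | Add "'a arith_formula list"
  | Mult "'a arith_formula list"

primrec formula_vars :: "'a arith_formula \<Rightarrow> nat set" where
  "formula_vars (Var i) = {i}"
| "formula_vars (Const c) = {}"
| "formula_vars (Add fs) = \<Union> (set (map formula_vars fs))"
| "formula_vars (Mult fs) = \<Union> (set (map formula_vars fs))"

primrec formula_poly :: "'a::comm_ring_1 arith_formula \<Rightarrow> 'a mpoly" where
  "formula_poly (Var i) = mVar i"
| "formula_poly (Const c) = mConst c"
| "formula_poly (Add fs) = sum_list (map formula_poly fs)"
| "formula_poly (Mult fs) = prod_list (map formula_poly fs)"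

definition computed_by_formula :: "nat \<Rightarrow> 'a::comm_ring_1 mpoly \<Rightarrow> bool" where
  "computed_by_formula n p \<longleftrightarrow>
     (\<exists>F. formula_vars F \<subseteq> {1..n} \<and> formula_poly F = p)"

definition affine_linear_form :: "nat \<Rightarrow> 'a::comm_ring_1 mpoly \<Rightarrow> bool" where
  "affine_linear_form n l \<longleftrightarrow>
     (\<exists>b a. l = mConst b + (\<Sum>i=1..n. mConst (a i) * mVar i))"

end

theory Submission imports Defs begin

text \<open>
  By induction on the formula, the polynomial is written as \<open>v \<bullet> M\<^sup>-\<^sup>1 u\<close> with constant vectors
  \<open>u\<close>, \<open>v\<close> and a matrix \<open>M\<close> of determinant \<open>1\<close> whose diagonal is affine and whose
  off-diagonal part is constant. An affine form \<open>p\<close> is obtained from the matrix with rows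
  \<open>(p, 1)\<close>, \<open>(-1, 0)\<close>, which moves it to an off-diagonal position of the inverse; sums come
  from block diagonal matrices, and products from block triangular ones, where only the constant
  block \<open>- u\<^sub>1 v\<^sub>2\<^sup>T\<close> is added. Finally \<open>p\<close> is the determinant of \<open>M\<close> bordered by \<open>u\<close> and \<open>-v\<close>.
\<close>

section \<open>Constants and affine linear forms\<close>

lemma mConst_0 [simp]: "mConst 0 = 0"
  by (simp add: mConst_def)

lemma mConst_1 [simp]: "mConst 1 = 1"
  by (simp add: mConst_def)

lemma mConst_uminus: "mConst (- c) = - mConst (c :: 'a::comm_ring_1)"
  by (simp add: mConst_def single_uminus)

lemma mConst_mult: "mConst (a * b) = mConst a * mConst (b :: 'a::comm_ring_1)"
  by (simp add: mConst_def mult_single)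

lemma range_mConst_simps [simp]:
  "0 \<in> range (mConst :: 'a::comm_ring_1 \<Rightarrow> _)"
  "1 \<in> range (mConst :: 'a::comm_ring_1 \<Rightarrow> _)"
  by (metis mConst_0 rangeI, metis mConst_1 rangeI)

lemma range_mConst_uminus [simp]:
  "a \<in> range mConst \<Longrightarrow> - a \<in> range (mConst :: 'a::comm_ring_1 \<Rightarrow> _)"
  by (auto simp flip: mConst_uminus)

lemma range_mConst_mult [simp]:
  "a \<in> range mConst \<Longrightarrow> b \<in> range mConst \<Longrightarrow> a * b \<in> range (mConst :: 'a::comm_ring_1 \<Rightarrow> _)"
  by (auto simp flip: mConst_mult)

lemma affine_linear_form_mConst: "affine_linear_form n (mConst c)"
  unfolding affine_linear_form_def by (intro exI[of _ c] exI[of _ "\<lambda>_. 0"]) simp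

lemma affine_linear_form_0 [simp]: "affine_linear_form n 0"
  using affine_linear_form_mConst[of n 0] by simp

lemma affine_linear_form_mVar:
  assumes "i \<in> {1..n}"
  shows "affine_linear_form n (mVar i :: 'a::comm_ring_1 mpoly)"
proof -
  have "(\<Sum>j=1..n. mConst (if j = i then 1 else 0) * mVar j) =
        (\<Sum>j=1..n. if j = i then mVar j else (0 :: 'a mpoly))"
    by (intro sum.cong) auto
  also have "\<dots> = mVar i"
    using assms by simp
  finally show ?thesis
    unfolding affine_linear_form_def by (intro exI[of _ 0] exI[of _ "\<lambda>j. if j = i then 1 else 0"]) simp
qed

section \<open>Matrices with affine diagonal and constant off-diagonal entries\<close>

definition dpp_mat :: "nat \<Rightarrow> nat \<Rightarrow> 'a::comm_ring_1 mpoly mat \<Rightarrow> bool" where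
  "dpp_mat n N M \<longleftrightarrow> M \<in> carrier_mat N N \<and>
     (\<forall>i<N. affine_linear_form n (M $$ (i, i))) \<and>
     (\<forall>i<N. \<forall>j<N. i \<noteq> j \<longrightarrow> M $$ (i, j) \<in> range mConst)"

definition const_vec :: "nat \<Rightarrow> 'a::comm_ring_1 mpoly vec \<Rightarrow> bool" where
  "const_vec N v \<longleftrightarrow> v \<in> carrier_vec N \<and> (\<forall>i<N. v $ i \<in> range mConst)"

lemma const_vec_append:
  assumes "const_vec N u" "const_vec K v"
  shows "const_vec (N + K) (u @\<^sub>v v)"
  using assms unfolding const_vec_def by auto

lemma const_vec_zero [simp]: "const_vec N (0\<^sub>v N)"
  by (auto simp: const_vec_def)

lemma dpp_mat_four_block:
  assumes "dpp_mat n N A" "dpp_mat n K D"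
    and "B \<in> carrier_mat N K" "\<And>i j. i < N \<Longrightarrow> j < K \<Longrightarrow> B $$ (i, j) \<in> range mConst"
    and "C \<in> carrier_mat K N" "\<And>i j. i < K \<Longrightarrow> j < N \<Longrightarrow> C $$ (i, j) \<in> range mConst"
  shows "dpp_mat n (N + K) (four_block_mat A B C D)"
  using assms unfolding dpp_mat_def by auto

text \<open>Membership in \<open>range mConst\<close> lets all matrix algebra stay over polynomials;
  the matrix over the coefficients is recovered only here.\<close>

lemma dpp_mat_decompose:
  assumes "dpp_mat n N M"
  obtains L l where "L \<in> carrier_mat N N" "\<forall>j<N. affine_linear_form n (l j)"
    "M = map_mat mConst L + mat_diag N l"
proof -
  \<comment> \<open>The diagonal of \<open>L\<close> is 0 because \<open>l\<close> takes over the
    whole diagonal of \<open>M\<close>, constant terms included.\<close>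
  define L where "L = mat N N (\<lambda>(i, j). if i = j then 0 else inv_into UNIV mConst (M $$ (i, j)))"
  define l where "l = (\<lambda>j. M $$ (j, j))"
  show thesis
  proof
    show "L \<in> carrier_mat N N" by (simp add: L_def)
    show "\<forall>j<N. affine_linear_form n (l j)" using assms by (simp add: dpp_mat_def l_def)
    show "M = map_mat mConst L + mat_diag N l"
      using assms by (intro eq_matI) (auto simp: dpp_mat_def L_def l_def mat_diag_def f_inv_into_f)
  qed
qed

text \<open>The vector \<open>y\<close> stands for \<open>M\<^sup>-\<^sup>1 u\<close>.\<close>

definition dpp_realizable :: "nat \<Rightarrow> 'a::comm_ring_1 mpoly \<Rightarrow> bool" where
  "dpp_realizable n p \<longleftrightarrow> (\<exists>N M u v y. dpp_mat n N M \<and> det M = 1 \<and>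
     const_vec N u \<and> const_vec N v \<and> y \<in> carrier_vec N \<and> M *\<^sub>v y = u \<and> v \<bullet> y = p)"

section \<open>Closure of realizable polynomials under sums and products\<close>

lemma zero_mat_mult_vec [simp]:
  "v \<in> carrier_vec k \<Longrightarrow> 0\<^sub>m m k *\<^sub>v v = 0\<^sub>v m"
  by (intro eq_vecI) auto

lemma dpp_realizable_affine:
  assumes "affine_linear_form n (p :: 'a::comm_ring_1 mpoly)"
  shows "dpp_realizable n p"
proof -
  define M where "M = mat_of_rows_list 2 [[p, 1], [-1, 0]]"
  let ?e = "unit_vec 2 1 :: 'a mpoly vec"
  \<comment> \<open>This is the second column of the inverse \<open>[[0, -1], [1, p]]\<close> of
    \<open>M\<close>; its last entry is \<open>p\<close>.\<close>
  let ?y = "vec 2 (\<lambda>i. if i = 0 then -1 else p)"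
  have carrier: "M \<in> carrier_mat 2 2"
    by (simp add: M_def mat_of_rows_list_def numeral_2_eq_2)
  have entries: "M $$ (0, 0) = p" "M $$ (0, 1) = 1" "M $$ (1, 0) = -1" "M $$ (1, 1) = 0"
    by (simp_all add: M_def mat_of_rows_list_def)
  have "dpp_mat n 2 M"
    using assms carrier entries by (auto simp: dpp_mat_def less_2_cases_iff)
  moreover have "det M = 1"
  proof -
    have "det M = (\<Sum>i<2. M $$ (i, 1) * cofactor M i 1)"
      using carrier by (rule laplace_expansion_column) simp
    also have "\<dots> = cofactor M 0 1"
      using entries by (simp add: numeral_2_eq_2)
    also have "\<dots> = - det (mat_delete M 0 1)" by (simp add: cofactor_def)
    also have "det (mat_delete M 0 1) = mat_delete M 0 1 $$ (0, 0)"
      using mat_delete_carrier[of M 1 1] carrier by (intro det_single) (auto simp: mat_delete_def)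
    also have "\<dots> = -1"
      using carrier entries by (simp add: mat_delete_def)
    finally show ?thesis by simp
  qed
  moreover have "const_vec 2 ?e"
    by (auto simp: const_vec_def unit_vec_def)
  moreover have "M *\<^sub>v ?y = ?e"
    using carrier entries by (intro eq_vecI) (auto simp: scalar_prod_def numeral_2_eq_2 less_Suc_eq)
  moreover have "?e \<bullet> ?y = p"
    by simp
  ultimately show ?thesis
    unfolding dpp_realizable_def by (meson vec_carrier)
qed

text \<open>The block diagonal system decouples, so stacking the two solutions adds the two scalar
  products.\<close>

lemma dpp_realizable_add:
  assumes "dpp_realizable n p" "dpp_realizable n q"
  shows "dpp_realizable n (p + q :: 'a::idom mpoly)"
proof -
  obtain N M u v y where 1: "dpp_mat n N M" "det M = 1" "const_vec N u" "const_vec N v"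
      "y \<in> carrier_vec N" "M *\<^sub>v y = u" "v \<bullet> y = p"
    using assms(1) unfolding dpp_realizable_def by blast
  obtain K M' u' v' y' where 2: "dpp_mat n K M'" "det M' = 1" "const_vec K u'" "const_vec K v'"
      "y' \<in> carrier_vec K" "M' *\<^sub>v y' = u'" "v' \<bullet> y' = q"
    using assms(2) unfolding dpp_realizable_def by blast
  have carrier [simp]: "M \<in> carrier_mat N N" "M' \<in> carrier_mat K K" "u \<in> carrier_vec N"
      "u' \<in> carrier_vec K" "v \<in> carrier_vec N" "v' \<in> carrier_vec K"
    using 1 2 by (auto simp: dpp_mat_def const_vec_def)
  let ?M = "four_block_mat M (0\<^sub>m N K) (0\<^sub>m K N) M'"
  have "dpp_mat n (N + K) ?M"
    using 1 2 by (intro dpp_mat_four_block) auto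
  moreover have "det ?M = 1"
    using det_four_block_mat_lower_left_zero[of M N "0\<^sub>m N K" K "0\<^sub>m K N" M'] 1 2 by simp
  moreover have "?M *\<^sub>v (y @\<^sub>v y') = u @\<^sub>v u'"
    using 1 2 by (subst four_block_mat_mult_vec[of _ N N _ K _ K]) auto
  moreover have "(v @\<^sub>v v') \<bullet> (y @\<^sub>v y') = p + q"
    using 1 2 by (subst scalar_prod_append[of _ N _ K]) auto
  ultimately show ?thesis
    unfolding dpp_realizable_def using 1 2 by (meson append_carrier_vec const_vec_append)
qed

text \<open>The lower block row forces \<open>y'\<close>. The upper one then reads
  \<open>M z = q u\<close>, solved by \<open>z = q y\<close>, and pairing \<open>z\<close> with
  \<open>v\<close> gives \<open>p * q\<close>.\<close>

lemma dpp_realizable_mult: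
  assumes "dpp_realizable n p" "dpp_realizable n q"
  shows "dpp_realizable n (p * q :: 'a::idom mpoly)"
proof -
  obtain N M u v y where 1: "dpp_mat n N M" "det M = 1" "const_vec N u" "const_vec N v"
      "y \<in> carrier_vec N" "M *\<^sub>v y = u" "v \<bullet> y = p"
    using assms(1) unfolding dpp_realizable_def by blast
  obtain K M' u' v' y' where 2: "dpp_mat n K M'" "det M' = 1" "const_vec K u'" "const_vec K v'"
      "y' \<in> carrier_vec K" "M' *\<^sub>v y' = u'" "v' \<bullet> y' = q"
    using assms(2) unfolding dpp_realizable_def by blast
  have carrier [simp]: "M \<in> carrier_mat N N" "M' \<in> carrier_mat K K" "u \<in> carrier_vec N"
      "u' \<in> carrier_vec K" "v \<in> carrier_vec N" "v' \<in> carrier_vec K"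
    using 1 2 by (auto simp: dpp_mat_def const_vec_def)
  \<comment> \<open>A constant block of rank at most one: it evaluates \<open>v'\<close> on the
    lower solution, giving \<open>q\<close>, and passes \<open>- q\<close> times \<open>u\<close> to
    the upper rows.\<close>
  define B where "B = mat N K (\<lambda>(i, j). - (u $ i * v' $ j))"
  have B [simp]: "B \<in> carrier_mat N K" by (simp add: B_def)
  have B_mult: "B *\<^sub>v y' = (- q) \<cdot>\<^sub>v u"
  proof (rule eq_vecI)
    fix i assume "i < dim_vec ((- q) \<cdot>\<^sub>v u)"
    then have i: "i < N" using carrier(3) by simp
    then have "(B *\<^sub>v y') $ i = (\<Sum>j<K. - (u $ i * v' $ j) * y' $ j)"
      using 2 by (auto simp: B_def scalar_prod_def atLeast0LessThan)
    also have "\<dots> = - ((\<Sum>j<K. v' $ j * y' $ j) * u $ i)"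
      unfolding sum_distrib_right sum_negf[symmetric] by (intro sum.cong) (auto simp: mult_ac)
    also have "(\<Sum>j<K. v' $ j * y' $ j) = q"
      using 2 by (auto simp: scalar_prod_def atLeast0LessThan)
    finally show "(B *\<^sub>v y') $ i = ((- q) \<cdot>\<^sub>v u) $ i"
      using i by (simp add: carrier_vecD[OF carrier(3)])
  qed (simp add: B_def carrier_vecD[OF carrier(3)])
  have M_mult: "M *\<^sub>v (q \<cdot>\<^sub>v y) = q \<cdot>\<^sub>v u"
  proof (rule eq_vecI)
    fix i assume "i < dim_vec (q \<cdot>\<^sub>v u)"
    then have i: "i < N" using carrier(3) by simp
    then have "(M *\<^sub>v (q \<cdot>\<^sub>v y)) $ i = q * (row M i \<bullet> y)"
      by (simp add: carrier_matD[OF carrier(1)] carrier_vecD[OF 1(5)])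
    also have "row M i \<bullet> y = u $ i"
      using i unfolding 1(6)[symmetric] by (simp add: carrier_matD[OF carrier(1)])
    finally show "(M *\<^sub>v (q \<cdot>\<^sub>v y)) $ i = (q \<cdot>\<^sub>v u) $ i"
      using i by (simp add: carrier_vecD[OF carrier(3)])
  qed (simp add: carrier_matD[OF carrier(1)] carrier_vecD[OF carrier(3)])
  have cancel: "q \<cdot>\<^sub>v u + (- q) \<cdot>\<^sub>v u = 0\<^sub>v N"
    by (intro eq_vecI) (simp_all add: carrier_vecD[OF carrier(3)])
  let ?M = "four_block_mat M B (0\<^sub>m K N) M'"
  have "dpp_mat n (N + K) ?M"
    using 1 2 by (intro dpp_mat_four_block) (auto simp: B_def const_vec_def)
  moreover have "det ?M = 1"
    using det_four_block_mat_lower_left_zero[of M N B K "0\<^sub>m K N" M'] 1 2 by simp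
  moreover have "?M *\<^sub>v ((q \<cdot>\<^sub>v y) @\<^sub>v y') = 0\<^sub>v N @\<^sub>v u'"
    using 1 2 by (subst four_block_mat_mult_vec[of _ N N _ K _ K]) (auto simp: B_mult M_mult cancel)
  moreover have "(v @\<^sub>v 0\<^sub>v K) \<bullet> ((q \<cdot>\<^sub>v y) @\<^sub>v y') = p * q"
    using 1 2 by (subst scalar_prod_append[of _ N _ K]) (auto simp: mult.commute)
  moreover have "(q \<cdot>\<^sub>v y) @\<^sub>v y' \<in> carrier_vec (N + K)"
    using 1 2 by simp
  ultimately show ?thesis
    unfolding dpp_realizable_def using 1 2 by (meson const_vec_append const_vec_zero)
qed

lemma dpp_realizable_formula:
  fixes F :: "'a::idom arith_formula"
  assumes "formula_vars F \<subseteq> {1..n}"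
  shows "dpp_realizable n (formula_poly F)"
  using assms
proof (induction F)
  case (Var i)
  then show ?case by (simp add: dpp_realizable_affine affine_linear_form_mVar)
next
  case (Const c)
  show ?case by (simp add: dpp_realizable_affine affine_linear_form_mConst)
next
  case (Add fs)
  \<comment> \<open>Ranging over all \<open>gs\<close> with members in \<open>fs\<close> lets the
    list induction use the hypothesis on the members of the fixed \<open>fs\<close>.\<close>
  have "dpp_realizable n (sum_list (map formula_poly gs))" if "set gs \<subseteq> set fs" for gs
    using that
  proof (induction gs)
    case Nil
    show ?case by (simp add: dpp_realizable_affine)
  next
    case (Cons g gs)
    have "dpp_realizable n (formula_poly g)" using Add Cons.prems by auto
    with Cons show ?case by (simp add: dpp_realizable_add)
  qed
  then show ?case by simp
next
  case (Mult fs)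
  have "dpp_realizable n (prod_list (map formula_poly gs))" if "set gs \<subseteq> set fs" for gs
    using that
  proof (induction gs)
    case Nil
    show ?case using affine_linear_form_mConst[of n "1 :: 'a"] by (simp add: dpp_realizable_affine)
  next
    case (Cons g gs)
    have "dpp_realizable n (formula_poly g)" using Mult Cons.prems by auto
    with Cons show ?case by (simp add: dpp_realizable_mult)
  qed
  then show ?case by simp
qed

text \<open>A Schur complement computation. Writing the border column as
  \<open>M *\<^sub>v y\<close> avoids inverting \<open>M\<close>.\<close>

lemma det_bordered:
  fixes M :: "'a::idom mat"
  assumes M: "M \<in> carrier_mat N N" and y: "y \<in> carrier_vec N" and v: "v \<in> carrier_vec N"
  shows "det (four_block_mat M (mat_of_cols N [M *\<^sub>v y]) (mat_of_rows N [- v]) (0\<^sub>m 1 1)) =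
         det M * (v \<bullet> y)"
proof -
  let ?Y = "mat_of_cols N [y]" and ?V = "mat_of_rows N [- v]"
  have carrier [simp]: "?Y \<in> carrier_mat N 1" "?V \<in> carrier_mat 1 N" by auto
  have U: "mat_of_cols N [M *\<^sub>v y] = M * ?Y"
    using M y by (intro eq_matI) (auto simp: mat_of_cols_def intro!: arg_cong2[where f = scalar_prod])
  have VY: "- (?V * ?Y) = mat 1 1 (\<lambda>_. v \<bullet> y)"
    using y v by (intro eq_matI) (auto simp: mat_of_rows_def mat_of_cols_def scalar_prod_def sum_negf)
  \<comment> \<open>Block elimination: the lower right corner of \<open>?A * ?B\<close> is
    \<open>?V * ?Y - ?V * ?Y = 0\<close>, while both factors are block triangular.\<close>
  let ?A = "four_block_mat M (0\<^sub>m N 1) ?V (- (?V * ?Y))"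
  let ?B = "four_block_mat (1\<^sub>m N) ?Y (0\<^sub>m 1 N) (1\<^sub>m 1)"
  have "four_block_mat M (mat_of_cols N [M *\<^sub>v y]) ?V (0\<^sub>m 1 1) = ?A * ?B"
    unfolding U using M by (subst mult_four_block_mat[of _ N N _ 1 _ 1 _ _ N _ 1]) auto
  also have "det (?A * ?B) = det ?A * det ?B"
    using M carrier by (intro det_mult[of _ "N + 1"] four_block_carrier_mat) auto
  also have "det ?A = det M * (v \<bullet> y)"
    using M by (subst det_four_block_mat_upper_right_zero[of _ N _ 1]) (auto simp: VY det_single)
  also have "det ?B = 1"
    by (subst det_four_block_mat_lower_left_zero[of _ N _ 1]) auto
  finally show ?thesis by simp
qed

theorem theorem6:
  fixes p :: "'a::field mpoly" and n :: nat
  assumes "computed_by_formula n p"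
  shows "\<exists>N (L :: 'a mat) (l :: nat \<Rightarrow> 'a mpoly).
           0 < N \<and> L \<in> carrier_mat N N \<and> (\<forall>j<N. affine_linear_form n (l j)) \<and>
           p = det (map_mat mConst L + mat_diag N l)"
proof -
  obtain N M u v y where *: "dpp_mat n N M" "det M = 1" "const_vec N u" "const_vec N v"
      "y \<in> carrier_vec N" "M *\<^sub>v y = u" "v \<bullet> y = p"
    using assms dpp_realizable_formula
    unfolding computed_by_formula_def dpp_realizable_def by metis
  \<comment> \<open>The sign of \<open>- v\<close> makes the determinant \<open>p\<close> rather
    than \<open>- p\<close>; the corner 0 is an affine form, and the border keeps the size positive
    even if \<open>N = 0\<close>.\<close>
  let ?M = "four_block_mat M (mat_of_cols N [u]) (mat_of_rows N [- v]) (0\<^sub>m 1 1)"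
  have "dpp_mat n (N + 1) ?M"
    using * by (intro dpp_mat_four_block) (auto simp: const_vec_def mat_of_cols_def mat_of_rows_def dpp_mat_def)
  then obtain L l where "L \<in> carrier_mat (N + 1) (N + 1)" "\<forall>j<N + 1. affine_linear_form n (l j)"
      "?M = map_mat mConst L + mat_diag (N + 1) l"
    by (rule dpp_mat_decompose)
  moreover have "det ?M = p"
    using * det_bordered[of M N y v] by (simp add: dpp_mat_def const_vec_def)
  ultimately show ?thesis
    by (intro exI[of _ "N + 1"] exI[of _ L] exI[of _ l]) simp
qed

end
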